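(* Suppose that $\mathbb E_{Q_j}[\Phi(\cdot,\xi)]$ and $\mathbb E_{Q_j}[\varphi(\cdot,\xi)]$ are continuous on $\mathcal X$ for $j\in\{1,\dots,n\}$ and the set $\mathcal X$ is bounded. Then, for any fixed $\hat\theta_N\in\Theta$, $\hat r_N\ge0$ and $\lambda>0$, the sets $\mathfrak X(\hat\theta_N,\hat r_N)$ and $\mathfrak X^\lambda(\hat\theta_N,\hat r_N)$ are nonempty and compact.
   Context: $\mathcal X\subseteq\mathbb R^d$ is a nonempty closed convex set with normal cone $\mathcal N_{\mathcal X}(x)=\{v\in\mathbb R^d\mid\langle v,y-x\rangle\le0\ \forall y\in\mathcal X\}$ at $x\in\mathcal X$. $Q_1,\dots,Q_n$ are fixed probability distributions on $\Xi\subseteq\mathbb R^m$. $\Phi:\mathcal X\times\Xi\to\mathbb R^d$ and $\varphi:\mathcal X\times\Xi\to\mathbb R$ are continuous in $x$ for fixed $\xi$ and measurable and integrable (with respect to each $Q_j$) in $\xi$ for fixed $x$. $\Theta=\{\theta\in\mathbb R^n_+\mid\sum_j\theta_j=1\}$, $\mathbb B(\theta,r)=\{\theta'\in\mathbb R^n\mid\|\theta'-\theta\|_\infty\le r\}$, and $\hat\Theta_N=\mathbb B(\hat\theta_N,\hat r_N)\cap\Theta$. For $\lambda\ge0$, $\mathfrak X^\lambda(\hat\theta_N,\hat r_N)$ is the set of all $x\in\mathcal X$ for which there exists $\theta\in\arg\max_{\theta'\in\hat\Theta_N}\{\sum_{j=1}^n\theta'_j\mathbb E_{Q_j}[\varphi(x,\xi)]-\lambda\|\theta'\|^2\}$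 (Euclidean norm) such that $0\in\sum_{j=1}^n\theta_j\mathbb E_{Q_j}[\Phi(x,\xi)]+\mathcal N_{\mathcal X}(x)$. Also $\mathfrak X(\hat\theta_N,\hat r_N):=\mathfrak X^0(\hat\theta_N,\hat r_N)$. *)

theory Defs
  imports "HOL-Probability.Probability"
begin

definition normal_cone :: "'a::real_inner set \<Rightarrow> 'a \<Rightarrow> 'a set" where
  "normal_cone X x = {v. \<forall>y\<in>X. v \<bullet> (y - x) \<le> 0}"

definition prob_simplex :: "(real ^ 'n) set" where
  "prob_simplex = {\<theta>. (\<forall>j. 0 \<le> \<theta> $ j) \<and> (\<Sum>j\<in>UNIV. \<theta> $ j) = 1}"

(* infnorm is the maximum norm of the coordinates *)
definition ambiguity_set :: "real ^ 'n \<Rightarrow> real \<Rightarrow> (real ^ 'n) set" where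
  "ambiguity_set \<theta>\<^sub>0 r = {\<theta>. infnorm (\<theta> - \<theta>\<^sub>0) \<le> r} \<inter> prob_simplex"

(* The support set of the random parameter is the common space of the measures Q j,
   so it is not a separate argument. *)
definition reg_solution_set ::
  "(real ^ 'd) set \<Rightarrow> ('n::finite \<Rightarrow> (real ^ 'm) measure) \<Rightarrow>
   (real ^ 'd \<Rightarrow> real ^ 'm \<Rightarrow> real ^ 'd) \<Rightarrow> (real ^ 'd \<Rightarrow> real ^ 'm \<Rightarrow> real) \<Rightarrow>
   real \<Rightarrow> real ^ 'n \<Rightarrow> real \<Rightarrow> (real ^ 'd) set" where
  "reg_solution_set X Q \<Phi> \<phi> lam \<theta>\<^sub>0 r =
     {x \<in> X. \<exists>\<theta>.
        is_arg_max
          (\<lambda>\<theta>'. (\<Sum>j\<in>UNIV. \<theta>' $ j * (\<integral>\<xi>. \<phi> x \<xi> \<partial>Q j)) - lam * (norm \<theta>')\<^sup>2)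
          (\<lambda>\<theta>'. \<theta>' \<in> ambiguity_set \<theta>\<^sub>0 r) \<theta> \<and>
        0 \<in> (\<lambda>v. (\<Sum>j\<in>UNIV. \<theta> $ j *\<^sub>R (\<integral>\<xi>. \<Phi> x \<xi> \<partial>Q j)) + v) ` normal_cone X x}"

definition solution_set ::
  "(real ^ 'd) set \<Rightarrow> ('n::finite \<Rightarrow> (real ^ 'm) measure) \<Rightarrow>
   (real ^ 'd \<Rightarrow> real ^ 'm \<Rightarrow> real ^ 'd) \<Rightarrow> (real ^ 'd \<Rightarrow> real ^ 'm \<Rightarrow> real) \<Rightarrow>
   real ^ 'n \<Rightarrow> real \<Rightarrow> (real ^ 'd) set" where
  "solution_set X Q \<Phi> \<phi> \<theta>\<^sub>0 r = reg_solution_set X Q \<Phi> \<phi> 0 \<theta>\<^sub>0 r"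

end

theory Submission
  imports Defs
begin

text \<open>
  Maximising \<open>u \<bullet> \<theta> - l * (norm \<theta>)\<^sup>2\<close> over a convex set for \<open>l > 0\<close> amounts to projecting
  \<open>u / (2 * l)\<close> onto it, so the regularised maximiser is a continuous function of \<open>x\<close>, and the
  variational inequality becomes a fixed point equation for a continuous self-map of \<open>X\<close>, solved by
  Brouwer's theorem. For \<open>l = 0\<close> no Kakutani-type theorem is needed: the triples
  \<open>(l, x, \<theta>)\<close> with \<open>0 \<le> l \<le> L\<close> form a compact set, and its projection to the \<open>l\<close>-axis contains
  \<open>{0<..L}\<close>, hence also \<open>0\<close>.
\<close>

text \<open>Completing the square: with \<open>a = u /\<^sub>R (2 * l)\<close>, the objective is a
  constant minus \<open>l\<close> times the squared distance to \<open>a\<close>, so the nearest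
  point of \<open>C\<close> is best.\<close>

lemma closest_point_maximizes_regularized:
  fixes C :: "'b::euclidean_space set"
  assumes "closed C" "\<theta> \<in> C" "0 < l"
  shows "u \<bullet> \<theta> - l * (norm \<theta>)\<^sup>2
    \<le> u \<bullet> closest_point C (u /\<^sub>R (2 * l)) - l * (norm (closest_point C (u /\<^sub>R (2 * l))))\<^sup>2"
proof -
  define a where "a = u /\<^sub>R (2 * l)"
  have u: "u = (2 * l) *\<^sub>R a"
    using assms(3) by (simp add: a_def)
  have square: "u \<bullet> \<eta> - l * (norm \<eta>)\<^sup>2 = l * (norm a)\<^sup>2 - l * (dist a \<eta>)\<^sup>2" for \<eta>
    unfolding u dist_norm power2_norm_eq_inner
    by (simp add: inner_diff_left inner_diff_right inner_commute algebra_simps)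
  have "dist a (closest_point C a) \<le> dist a \<theta>"
    using assms by (intro closest_point_le) auto
  then have "l * (dist a (closest_point C a))\<^sup>2 \<le> l * (dist a \<theta>)\<^sup>2"
    using assms(3) by (intro mult_left_mono power_mono) auto
  then show ?thesis
    unfolding a_def[symmetric] square by simp
qed

text \<open>The problem stripped of probability: \<open>C\<close> stands for the ambiguity set,
  \<open>c x\<close> for the vector of expected costs, and \<open>G x \<theta>\<close> for the
  \<open>\<theta>\<close>-mixture of expected operators.\<close>

locale coupled_vi =
  fixes X :: "'a::euclidean_space set" and C :: "'b::euclidean_space set"
    and G :: "'a \<Rightarrow> 'b \<Rightarrow> 'a" and c :: "'a \<Rightarrow> 'b"
  assumes X: "compact X" "convex X" "X \<noteq> {}"
    and C: "compact C" "convex C" "C \<noteq> {}"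
    and G: "continuous_on (X \<times> C) (\<lambda>p. G (fst p) (snd p))"
    and c: "continuous_on X c"
begin

text \<open>The maximiser \<open>\<theta>\<close> stays visible and optimality is spelled out
  pointwise, so that the condition is closed jointly in \<open>(l, x, \<theta>)\<close>. The last
  conjunct is the normal cone inclusion.\<close>

definition is_sol :: "real \<Rightarrow> 'a \<Rightarrow> 'b \<Rightarrow> bool" where
  "is_sol l x \<theta> \<longleftrightarrow>
     x \<in> X \<and> \<theta> \<in> C \<and>
     (\<forall>\<eta>\<in>C. c x \<bullet> \<eta> - l * (norm \<eta>)\<^sup>2 \<le> c x \<bullet> \<theta> - l * (norm \<theta>)\<^sup>2) \<and>
     (\<forall>y\<in>X. 0 \<le> G x \<theta> \<bullet> (y - x))"

definition sols :: "real \<Rightarrow> 'a set" where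
  "sols l = {x. \<exists>\<theta>. is_sol l x \<theta>}"

lemma ex_sol_regularized:
  assumes "0 < l"
  shows "sols l \<noteq> {}"
proof -
  define t where "t x = closest_point C (c x /\<^sub>R (2 * l))" for x
  \<comment> \<open>Projected step map: its fixed points are the solutions of the variational
    inequality for \<open>\<lambda>x. G x (t x)\<close>.\<close>
  define h where "h x = closest_point X (x - G x (t x))" for x
  note closed = compact_imp_closed[OF X(1)] compact_imp_closed[OF C(1)]
  have tC: "t x \<in> C" for x
    unfolding t_def using closed C by (intro closest_point_in_set)
  have "continuous_on X t"
    unfolding t_def using closed C
    by (intro continuous_on_compose2[OF continuous_on_closest_point[of C UNIV]] continuous_intros c)
      auto
  then have "continuous_on X (\<lambda>x. G x (t x))"
    using continuous_on_compose2[OF G, of X "\<lambda>x. (x, t x)"] tC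
    by (simp add: continuous_on_Pair image_subset_iff)
  then have "continuous_on X h"
    unfolding h_def using closed X
    by (intro continuous_on_compose2[OF continuous_on_closest_point[of X UNIV]] continuous_intros)
      auto
  moreover have "h \<in> X \<rightarrow> X"
    unfolding h_def using closed X by (auto intro: closest_point_in_set)
  ultimately obtain x where x: "x \<in> X" "h x = x"
    using brouwer[of X h] X by blast
  \<comment> \<open>Obtuse angle property of the projection: at a fixed point the residual is
    \<open>- G x (t x)\<close>, and its inner product with \<open>y - x\<close> is at most
    \<open>0\<close>.\<close>
  have "0 \<le> G x (t x) \<bullet> (y - x)" if "y \<in> X" for y
    using closest_point_dot[of X y "x - G x (t x)"] that closed X x
    unfolding h_def by simp
  moreover have "c x \<bullet> \<eta> - l * (norm \<eta>)\<^sup>2 \<le> c x \<bullet> t x - l * (norm (t x))\<^sup>2" if "\<eta> \<in> C" for \<eta>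
    unfolding t_def by (rule closest_point_maximizes_regularized[OF closed(2) that assms])
  ultimately have "is_sol l x (t x)"
    using x tC by (simp add: is_sol_def)
  then show ?thesis
    by (auto simp: sols_def)
qed

text \<open>For each fixed competitor \<open>\<eta>\<close> or \<open>y\<close>, the condition is a
  non-strict inequality between continuous functions on a compact product; intersecting over all
  competitors preserves closedness.\<close>

lemma compact_sol_graph: "compact {(l, x, \<theta>). l \<in> {a..b} \<and> is_sol l x \<theta>}"
proof -
  define D where "D = {a..b} \<times> X \<times> C"
  define A where "A = (\<Inter>\<eta>\<in>C. {p\<in>D. c (fst (snd p)) \<bullet> \<eta> - fst p * (norm \<eta>)\<^sup>2
    \<le> c (fst (snd p)) \<bullet> snd (snd p) - fst p * (norm (snd (snd p)))\<^sup>2})"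
  define B where "B = (\<Inter>y\<in>X. {p\<in>D. 0 \<le> G (fst (snd p)) (snd (snd p)) \<bullet> (y - fst (snd p))})"
  have D: "compact D"
    unfolding D_def using X C by (intro compact_Times) auto
  have c': "continuous_on D (\<lambda>p. c (fst (snd p)))"
    by (rule continuous_on_compose2[OF c]) (auto simp: D_def intro!: continuous_intros)
  have G': "continuous_on D (\<lambda>p. G (fst (snd p)) (snd (snd p)))"
    by (rule continuous_on_compose2[OF G]) (auto simp: D_def intro!: continuous_intros)
  have "closed A"
    unfolding A_def using D
    by (intro closed_INT ballI continuous_on_closed_Collect_le continuous_intros c' compact_imp_closed)
  moreover have "closed B"
    unfolding B_def using D
    by (intro closed_INT ballI continuous_on_closed_Collect_le continuous_intros G' compact_imp_closed)
  ultimately have "compact (D \<inter> (A \<inter> B))"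
    using D by (intro compact_Int_closed closed_Int)
  moreover have "D \<inter> (A \<inter> B) = {(l, x, \<theta>). l \<in> {a..b} \<and> is_sol l x \<theta>}"
    unfolding D_def A_def B_def is_sol_def by auto
  ultimately show ?thesis
    by simp
qed

lemma compact_sols: "compact (sols l)"
proof -
  \<comment> \<open>The degenerate interval \<open>{l..l}\<close> selects the slice of the graph at
    \<open>l\<close>.\<close>
  have "sols l = (\<lambda>p. fst (snd p)) ` {(k, x, \<theta>). k \<in> {l..l} \<and> is_sol k x \<theta>}"
    by (force simp: sols_def)
  also have "compact \<dots>"
    by (intro compact_continuous_image compact_sol_graph continuous_intros)
  finally show ?thesis .
qed

lemma ex_sol_unregularized: "sols 0 \<noteq> {}"
proof -
  \<comment> \<open>The upper end \<open>1\<close> is arbitrary; what matters is that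
    \<open>0\<close> is a limit of positive parameters.\<close>
  define T where "T = fst ` {(l, x, \<theta>). l \<in> {0..1} \<and> is_sol l x \<theta>}"
  have "closed T"
    unfolding T_def
    by (intro compact_imp_closed compact_continuous_image compact_sol_graph continuous_intros)
  moreover have "{0<..<1} \<subseteq> T"
  proof
    fix l :: real assume l: "l \<in> {0<..<1}"
    then obtain x \<theta> where "is_sol l x \<theta>"
      using ex_sol_regularized[of l] by (auto simp: sols_def)
    with l show "l \<in> T"
      unfolding T_def by force
  qed
  ultimately have "closure {0<..<1} \<subseteq> T"
    by (rule closure_minimal[rotated])
  then have "0 \<in> T"
    by auto
  then show ?thesis
    unfolding T_def sols_def by force
qed

end

text \<open>The type's own norm is Euclidean, so convexity of the \<open>infnorm\<close> ball is
  derived from the triangle inequality and homogeneity of \<open>infnorm\<close>.\<close>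

lemma convex_ambiguity_set: "convex (ambiguity_set \<theta>\<^sub>0 r)"
proof -
  have "convex {\<theta>. infnorm (\<theta> - \<theta>\<^sub>0) \<le> r}"
  proof (rule convexI)
    fix x y :: "real ^ 'a" and u v :: real
    assume xy: "x \<in> {\<theta>. infnorm (\<theta> - \<theta>\<^sub>0) \<le> r}" "y \<in> {\<theta>. infnorm (\<theta> - \<theta>\<^sub>0) \<le> r}"
      and uv: "0 \<le> u" "0 \<le> v" "u + v = 1"
    have "u *\<^sub>R x + v *\<^sub>R y - \<theta>\<^sub>0 = u *\<^sub>R (x - \<theta>\<^sub>0) + v *\<^sub>R (y - \<theta>\<^sub>0)"
      using uv(3) by (simp add: algebra_simps flip: scaleR_add_left)
    then have "infnorm (u *\<^sub>R x + v *\<^sub>R y - \<theta>\<^sub>0) \<le> u * infnorm (x - \<theta>\<^sub>0) + v * infnorm (y - \<theta>\<^sub>0)"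
      using infnorm_triangle[of "u *\<^sub>R (x - \<theta>\<^sub>0)" "v *\<^sub>R (y - \<theta>\<^sub>0)"] uv by (simp add: infnorm_mul)
    also have "\<dots> \<le> r"
      using xy uv by (intro convex_bound_le) auto
    finally show "u *\<^sub>R x + v *\<^sub>R y \<in> {\<theta>. infnorm (\<theta> - \<theta>\<^sub>0) \<le> r}"
      by simp
  qed
  moreover have "convex (prob_simplex :: (real ^ 'a) set)"
    by (auto simp: convex_def prob_simplex_def sum.distrib simp flip: sum_distrib_left)
  ultimately show ?thesis
    unfolding ambiguity_set_def by (rule convex_Int)
qed

lemma compact_prob_simplex: "compact (prob_simplex :: (real ^ 'n) set)"
proof -
  have eq: "prob_simplex
    = (\<Inter>j. {\<theta> :: real ^ 'n. 0 \<le> \<theta> $ j}) \<inter> {\<theta>. (\<Sum>j\<in>UNIV. \<theta> $ j) = 1}"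
    by (auto simp: prob_simplex_def)
  have "closed (prob_simplex :: (real ^ 'n) set)"
    unfolding eq
    by (intro closed_Int closed_INT ballI closed_Collect_le closed_Collect_eq continuous_intros)
  \<comment> \<open>The Euclidean norm is at most the sum of the absolute coordinates, which is
    \<open>1\<close> on the simplex.\<close>
  moreover have "norm \<theta> \<le> 1" if "\<theta> \<in> prob_simplex" for \<theta> :: "real ^ 'n"
    using norm_le_l1_cart[of \<theta>] that by (simp add: prob_simplex_def)
  then have "bounded (prob_simplex :: (real ^ 'n) set)"
    by (rule boundedI)
  ultimately show ?thesis
    by (simp add: compact_eq_bounded_closed)
qed

lemma compact_ambiguity_set: "compact (ambiguity_set \<theta>\<^sub>0 r)"
  unfolding ambiguity_set_def
  by (intro closed_Int_compact compact_prob_simplex closed_Collect_le continuous_intros)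

text \<open>Provides the nonemptiness of \<open>C\<close> that the locale demands.\<close>

lemma center_in_ambiguity_set:
  assumes "\<theta>\<^sub>0 \<in> prob_simplex" "0 \<le> r"
  shows "\<theta>\<^sub>0 \<in> ambiguity_set \<theta>\<^sub>0 r"
  using assms by (simp add: ambiguity_set_def infnorm_0)

lemma is_arg_max_iff_le:
  fixes f :: "'a \<Rightarrow> 'b::linorder"
  shows "is_arg_max f P x \<longleftrightarrow> P x \<and> (\<forall>y. P y \<longrightarrow> f y \<le> f x)"
  by (auto simp: is_arg_max_def not_less)

text \<open>The only \<open>v\<close> with \<open>g + v = 0\<close> is \<open>- g\<close>, so the
  inclusion says that \<open>- g\<close> is a normal vector.\<close>

lemma zero_mem_plus_normal_cone_iff:
  "0 \<in> (\<lambda>v. g + v) ` normal_cone X x \<longleftrightarrow> (\<forall>y\<in>X. 0 \<le> g \<bullet> (y - x))"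
proof -
  have "0 \<in> (\<lambda>v. g + v) ` normal_cone X x \<longleftrightarrow> - g \<in> normal_cone X x"
    by (metis (no_types, lifting) add.right_inverse image_iff neg_eq_iff_add_eq_0)
  then show ?thesis
    by (simp add: normal_cone_def)
qed

theorem proposition1:
  fixes X :: "(real ^ 'd) set"
    and \<Xi> :: "(real ^ 'm) set"
    and Q :: "'n::finite \<Rightarrow> (real ^ 'm) measure"
    and \<Phi> :: "real ^ 'd \<Rightarrow> real ^ 'm \<Rightarrow> real ^ 'd"
    and \<phi> :: "real ^ 'd \<Rightarrow> real ^ 'm \<Rightarrow> real"
    and \<theta>\<^sub>0 :: "real ^ 'n"
    and r lam :: real
  assumes "X \<noteq> {}" and "closed X" and "convex X"
    and "\<And>j. prob_space (Q j)"
    and "\<And>j. space (Q j) = \<Xi>"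
    and "\<And>j. sets (Q j) = sets (restrict_space borel \<Xi>)"
    and "\<And>\<xi>. \<xi> \<in> \<Xi> \<Longrightarrow> continuous_on X (\<lambda>x. \<Phi> x \<xi>)"
    and "\<And>\<xi>. \<xi> \<in> \<Xi> \<Longrightarrow> continuous_on X (\<lambda>x. \<phi> x \<xi>)"
    and "\<And>x j. x \<in> X \<Longrightarrow> integrable (Q j) (\<Phi> x)"
    and "\<And>x j. x \<in> X \<Longrightarrow> integrable (Q j) (\<phi> x)"
    and "\<And>j. continuous_on X (\<lambda>x. \<integral>\<xi>. \<Phi> x \<xi> \<partial>Q j)"
    and "\<And>j. continuous_on X (\<lambda>x. \<integral>\<xi>. \<phi> x \<xi> \<partial>Q j)"
    and "bounded X"
    and "\<theta>\<^sub>0 \<in> prob_simplex" and "0 \<le> r" and "0 < lam"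
  shows "solution_set X Q \<Phi> \<phi> \<theta>\<^sub>0 r \<noteq> {} \<and> compact (solution_set X Q \<Phi> \<phi> \<theta>\<^sub>0 r) \<and>
    reg_solution_set X Q \<Phi> \<phi> lam \<theta>\<^sub>0 r \<noteq> {} \<and> compact (reg_solution_set X Q \<Phi> \<phi> lam \<theta>\<^sub>0 r)"
proof -
  define G where "G x \<theta> = (\<Sum>j\<in>UNIV. \<theta> $ j *\<^sub>R (\<integral>\<xi>. \<Phi> x \<xi> \<partial>Q j))" for x and \<theta> :: "real ^ 'n"
  define c :: "real ^ 'd \<Rightarrow> real ^ 'n" where "c x = (\<chi> j. \<integral>\<xi>. \<phi> x \<xi> \<partial>Q j)" for x
  have "continuous_on (X \<times> ambiguity_set \<theta>\<^sub>0 r) (\<lambda>p. G (fst p) (snd p))"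
    unfolding G_def
    by (intro continuous_intros continuous_on_compose2[OF assms(11)]) auto
  moreover have "continuous_on X c"
    unfolding c_def by (intro continuous_intros assms(12))
  \<comment> \<open>Boundedness of \<open>X\<close> enters here, through compactness.\<close>
  ultimately interpret coupled_vi X "ambiguity_set \<theta>\<^sub>0 r" G c
    using assms compact_ambiguity_set[of \<theta>\<^sub>0 r] convex_ambiguity_set[of \<theta>\<^sub>0 r]
      center_in_ambiguity_set[of \<theta>\<^sub>0 r]
    by unfold_locales (auto simp: compact_eq_bounded_closed)
  have objective: "(\<Sum>j\<in>UNIV. \<theta> $ j * (\<integral>\<xi>. \<phi> x \<xi> \<partial>Q j)) = c x \<bullet> \<theta>" for x \<theta>
    by (simp add: c_def inner_vec_def mult.commute)
  \<comment> \<open>Proved for every \<open>l\<close>, to serve both \<open>lam\<close> and the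
    value \<open>0\<close> in \<open>solution_set\<close>.\<close>
  have "reg_solution_set X Q \<Phi> \<phi> l \<theta>\<^sub>0 r = sols l" for l
    unfolding reg_solution_set_def sols_def is_sol_def objective is_arg_max_iff_le
      zero_mem_plus_normal_cone_iff G_def[symmetric]
    by blast
  then show ?thesis
    using ex_sol_unregularized ex_sol_regularized[OF \<open>0 < lam\<close>] compact_sols
    by (simp add: solution_set_def)
qed

end
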